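(* Let $\ell,m\in\mathbb N$ with $1\le\ell\le m$, $\alpha\in\mathbb R\setminus\{2j-1\}_{1\le j\le\ell}$, $\rho\in(0,\infty)$, and let $(a,b)$ be either $(0,\rho)$ or $(\rho,\infty)$. Then the constant $A(\ell,\alpha)=\prod_{j=1}^{\ell}\big(\frac{2j-1-\alpha}{2}\big)^2$ is sharp in the inequality $$\int_a^b x^\alpha|f^{(m)}(x)|^2dx\ \ge\ A(\ell,\alpha)\int_a^b x^{\alpha-2\ell}|f^{(m-\ell)}(x)|^2dx,$$ both for $f\in C_0^\infty((a,b))$ and for $f\in\dot H_0^m((a,b);x^\alpha dx)$; that is, for every $C>A(\ell,\alpha)$ there exists $f\in C_0^\infty((a,b))\subset \dot H_0^m((a,b);x^\alpha dx)$ with $$\int_a^b x^\alpha|f^{(m)}(x)|^2dx\ <\ C\int_a^b x^{\alpha-2\ell}|f^{(m-\ell)}(x)|^2dx .$$ In particular, for every $N\in\mathbb N$, $A(\ell,\alpha)$ cannot be replaced by any larger constant in the logarithmically refined inequalities $$\int_a^b x^\alpha|f^{(m)}(x)|^2dx\ \ge\ \int_a^b x^{\alpha-2\ell}\big[A(\ell,\alpha)+W_{\ell,\alpha,N}(\lambda_1(x),\dots,\lambda_N(x))\big]|f^{(m-\ell)}(x)|^2dx$$ on these function spaces, where either $\lambda_p(x)=[\ln_p(x/\gamma)]^{-1}$ with $\rho\ge e_N\gamma>0$, or $\lambda_p(x)=L_p(\tau/x)$ with $\rho\ge\tau>0$, when $(a,b)=(\rho,\infty)$; and either $\lambda_p(x)=[\ln_p(\gamma/x)]^{-1}$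 with $\gamma\ge e_N\rho$, $\gamma<\infty$, or $\lambda_p(x)=L_p(x/\tau)$ with $\rho\le\tau<\infty$, when $(a,b)=(0,\rho)$ ($1\le p\le N$).
   Context: $\mathbb N=\{1,2,\dots\}$; functions are complex-valued; $C_0^\infty((a,b))$ denotes the smooth functions with compact support in the open interval $(a,b)$. $\dot H_0^m((a,b);x^\alpha dx)$ is the closure of $C_0^\infty((a,b))$ in the norm $|||f|||_{m,\alpha}=\big(\int_a^b x^\alpha|f^{(m)}(x)|^2dx\big)^{1/2}$. Iterated logarithms: $\ln_1=\ln$, $\ln_{j+1}(\cdot)=\ln(\ln_j(\cdot))$. Normalized iterated logarithms: $L_1(s)=(1-\ln s)^{-1}$, $L_{j+1}(s)=L_1(L_j(s))$ for $s\in(0,1]$. Iterated exponentials: $e_0=0$, $e_{j+1}=e^{e_j}$. Constants: for $m\in\mathbb N$, $\alpha\in\mathbb R$, $A(m,\alpha)=\prod_{j=1}^m\big(\frac{2j-1-\alpha}{2}\big)^2$, $B(m,\alpha)=4^{-m}\sum_{k=1}^m\prod_{1\le j\le m,\,j\ne k}(2j-1-\alpha)^2$, and $c_i(m,\alpha)$, $0\le i\le2m$, are the coefficients in $\sum_{i=0}^{2m}c_i(m,\alpha)\lambda^i=\prod_{j=1}^m\big(\lambda^2-\frac{(2j-1-\alpha)^2}{4}\big)$. For nonnegative reals $\lambda_1,\dots,\lambda_N$ the (nonnegative) quantity $W_{\ell,\alpha,N}$ is $$W_{\ell,\alpha,N}(\lambda_1,\dots,\lambda_N)=B(\ell,\alpha)\sum_{k=1}^N\prod_{p=1}^k\lambda_p^2+\sum_{j=2}^{\ell}|c_{2j}(\ell,\alpha)|\,\lambda_1^{2j}\Big[A(j,0)+B(j,0)\sum_{k=1}^{N-1}\prod_{p=1}^k\lambda_{p+1}^2\Big],$$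 with empty sums equal to $0$. *)

theory Defs
  imports "HOL-Analysis.Analysis" "HOL-Computational_Algebra.Polynomial"
begin

definition nth_vderiv :: "nat \<Rightarrow> (real \<Rightarrow> complex) \<Rightarrow> real \<Rightarrow> complex" where
  "nth_vderiv k f = ((\<lambda>g x. vector_derivative g (at x)) ^^ k) f"

text \<open>A function with compact support in the open set \<open>I\<close> is represented by its
  extension by zero to the whole real line.\<close>

definition C0_infinity :: "real set \<Rightarrow> (real \<Rightarrow> complex) set" where
  "C0_infinity I = {f. (\<forall>k x. nth_vderiv k f differentiable (at x)) \<and>
     compact (closure {x. f x \<noteq> 0}) \<and> closure {x. f x \<noteq> 0} \<subseteq> I}"

definition locally_integrable_on :: "real set \<Rightarrow> (real \<Rightarrow> complex) \<Rightarrow> bool" where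
  "locally_integrable_on I f \<longleftrightarrow> (\<forall>K. compact K \<longrightarrow> K \<subseteq> I \<longrightarrow> set_integrable lborel K f)"

definition weak_deriv_on ::
    "real set \<Rightarrow> nat \<Rightarrow> (real \<Rightarrow> complex) \<Rightarrow> (real \<Rightarrow> complex) \<Rightarrow> bool" where
  "weak_deriv_on I k f g \<longleftrightarrow> locally_integrable_on I f \<and> locally_integrable_on I g \<and>
     (\<forall>\<phi>\<in>C0_infinity I. (LINT x:I|lborel. f x * nth_vderiv k \<phi> x)
                        = (-1) ^ k * (LINT x:I|lborel. g x * \<phi> x))"

text \<open>The closure of the test functions in the norm
  \<open>(\<integral>\<^sub>I x\<^sup>\<alpha> |f\<^sup>(\<^sup>m\<^sup>)(x)|\<^sup>2 dx)\<^sup>1\<^sup>/\<^sup>2\<close>, as a space of functions on \<open>I\<close>; it is only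
  used for \<open>I = (0,\<rho>)\<close> and \<open>I = (\<rho>,\<infinity>)\<close>.
  On functions that need not vanish near the end points the expression is merely a seminorm,
  with the polynomials of degree less than \<open>m\<close> in its kernel. For these \<open>I\<close>, a sequence of
  test functions that is Cauchy in the norm also converges in \<open>L\<^sup>1\<^sub>l\<^sub>o\<^sub>c(I)\<close> (integrate \<open>m\<close> times
  from \<open>\<rho>\<close>); requiring this convergence singles out the right limit and excludes these polynomials.
  Elements are functions rather than classes modulo equality almost everywhere on \<open>I\<close>, and their
  values outside \<open>I\<close> are irrelevant.\<close>

definition H0_dot :: "nat \<Rightarrow> real \<Rightarrow> real set \<Rightarrow> (real \<Rightarrow> complex) set" where
  "H0_dot m \<alpha> I = {f. \<exists>g \<phi>. weak_deriv_on I m f g \<and> (\<forall>n. \<phi> n \<in> C0_infinity I) \<and>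
     (\<lambda>n::nat. \<integral>\<^sup>+x\<in>I. ennreal (x powr \<alpha> * (cmod (nth_vderiv m (\<phi> n) x - g x))\<^sup>2) \<partial>lborel)
        \<longlonglongrightarrow> 0 \<and>
     (\<forall>K. compact K \<longrightarrow> K \<subseteq> I \<longrightarrow> (\<lambda>n. LINT x:K|lborel. cmod (\<phi> n x - f x)) \<longlonglongrightarrow> 0)}"

definition iter_ln :: "nat \<Rightarrow> real \<Rightarrow> real" where
  "iter_ln j = ln ^^ j"

definition norm_iter_ln :: "nat \<Rightarrow> real \<Rightarrow> real" where
  "norm_iter_ln j = (\<lambda>s. inverse (1 - ln s)) ^^ j"

definition iter_exp :: "nat \<Rightarrow> real" where
  "iter_exp j = (exp ^^ j) 0"

definition A_const :: "nat \<Rightarrow> real \<Rightarrow> real" where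
  "A_const m \<alpha> = (\<Prod>j=1..m. ((2 * real j - 1 - \<alpha>) / 2)\<^sup>2)"

definition B_const :: "nat \<Rightarrow> real \<Rightarrow> real" where
  "B_const m \<alpha> = (1 / 4 ^ m) * (\<Sum>k=1..m. \<Prod>j\<in>{1..m} - {k}. (2 * real j - 1 - \<alpha>)\<^sup>2)"

definition c_const :: "nat \<Rightarrow> nat \<Rightarrow> real \<Rightarrow> real" where
  "c_const i m \<alpha> = coeff (\<Prod>j=1..m. [:- ((2 * real j - 1 - \<alpha>)\<^sup>2 / 4), 0, 1:]) i"

definition W_weight :: "nat \<Rightarrow> real \<Rightarrow> nat \<Rightarrow> (nat \<Rightarrow> real) \<Rightarrow> real" where
  "W_weight l \<alpha> N lam =
     B_const l \<alpha> * (\<Sum>k=1..N. \<Prod>p=1..k. (lam p)\<^sup>2)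
     + (\<Sum>j=2..l. \<bar>c_const (2 * j) l \<alpha>\<bar> * lam 1 ^ (2 * j) *
         (A_const j 0 + B_const j 0 * (\<Sum>k=1..N - 1. \<Prod>p=1..k. (lam (p + 1))\<^sup>2)))"

definition weighted_ineq_C0 ::
    "real set \<Rightarrow> nat \<Rightarrow> nat \<Rightarrow> real \<Rightarrow> (real \<Rightarrow> real) \<Rightarrow> bool" where
  "weighted_ineq_C0 I m l \<alpha> V \<longleftrightarrow> (\<forall>f\<in>C0_infinity I.
     (LINT x:I|lborel. x powr \<alpha> * (cmod (nth_vderiv m f x))\<^sup>2)
     \<ge> (LINT x:I|lborel. x powr (\<alpha> - 2 * real l) * V x * (cmod (nth_vderiv (m - l) f x))\<^sup>2))"

text \<open>Below, \<open>g\<close> and \<open>h\<close> range over all versions of the weak derivatives of order \<open>m\<close> and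
  \<open>m - l\<close> of \<open>f\<close>; these agree almost everywhere on \<open>I\<close>.\<close>

definition weighted_ineq_H0 ::
    "real set \<Rightarrow> nat \<Rightarrow> nat \<Rightarrow> real \<Rightarrow> (real \<Rightarrow> real) \<Rightarrow> bool" where
  "weighted_ineq_H0 I m l \<alpha> V \<longleftrightarrow> (\<forall>f\<in>H0_dot m \<alpha> I. \<forall>g h.
     weak_deriv_on I m f g \<longrightarrow> weak_deriv_on I (m - l) f h \<longrightarrow>
     (LINT x:I|lborel. x powr \<alpha> * (cmod (g x))\<^sup>2)
     \<ge> (LINT x:I|lborel. x powr (\<alpha> - 2 * real l) * V x * (cmod (h x))\<^sup>2))"

end

theory Submission
  imports Defs
begin

text \<open>The power \<open>x\<^sup>z\<close> with \<open>Re z = m - (1 + \<alpha>) / 2\<close> is critical: after the substitution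
  \<open>t = ln x\<close> all powers of \<open>x\<close> in both integrals cancel. Cut off on the logarithmic scale,
  \<open>f(x) = x\<^sup>z \<psi>(\<delta> ln (x / \<rho>))\<close> with a bump function \<open>\<psi>\<close>, its quotient of integrals tends, as \<open>\<delta> \<down> 0\<close>,
  to the product of the \<open>|z - i|\<^sup>2\<close> over \<open>m - l \<le> i < m\<close>, which equals \<open>A(l, \<alpha>)\<close> for real \<open>z\<close>.
  A small imaginary part of \<open>z\<close> keeps the factors with \<open>i < m - l\<close>, common to both integrals, from
  vanishing. The logarithmic weights are nonnegative, so they only strengthen the refuted inequalities.\<close>

section \<open>Iterated derivatives\<close>

lemma nth_vderiv_0 [simp]: "nth_vderiv 0 f = f"
  by (simp add: nth_vderiv_def)

lemma nth_vderiv_Suc: "nth_vderiv (Suc k) f x = vector_derivative (nth_vderiv k f) (at x)"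
  by (simp add: nth_vderiv_def)

lemma nth_vderiv_nth_vderiv: "nth_vderiv j (nth_vderiv k f) = nth_vderiv (j + k) f"
  by (simp add: nth_vderiv_def funpow_add)

lemma nth_vderiv_eqI:
  assumes "\<And>k x. (F k has_vector_derivative F (Suc k) x) (at x)"
  shows "nth_vderiv k (F 0) = F k"
proof (induction k)
  case (Suc k)
  then show ?case
    using vector_derivative_at[OF assms] by (auto simp: nth_vderiv_Suc)
qed auto

text \<open>Membership in a class closed under differentiation replaces a formula for the k-th
  derivative; smoothness of the bump functions is proved this way.\<close>

lemma nth_vderiv_in_derivation_closed:
  assumes S: "\<And>f. f \<in> S \<Longrightarrow> \<exists>g\<in>S. \<forall>x. (f has_vector_derivative g x) (at x)"
    and "f \<in> S"
  shows "nth_vderiv k f \<in> S"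
proof (induction k)
  case (Suc k)
  obtain g where g: "g \<in> S" "\<forall>x. (nth_vderiv k f has_vector_derivative g x) (at x)"
    using S[OF Suc] by blast
  have "nth_vderiv (Suc k) f = g"
    using g by (auto simp: nth_vderiv_Suc fun_eq_iff intro: vector_derivative_at)
  then show ?case using g by simp
qed (use assms in auto)

section \<open>Bump functions\<close>

text \<open>For \<open>p = 1\<close> this is the standard function exp(-1/x), flat at 0; the
  polynomial in 1/x keeps the family closed under differentiation.\<close>

definition flat :: "real poly \<Rightarrow> real \<Rightarrow> real" where
  "flat p x = (if x > 0 then poly p (inverse x) * exp (- inverse x) else 0)"

lemma poly_times_exp_minus_tendsto_0:
  "((\<lambda>y. poly p y * exp (- y)) \<longlongrightarrow> (0::real)) at_top"
proof -
  have "((\<lambda>y. \<Sum>i\<le>degree p. coeff p i * (y ^ i / exp y)) \<longlongrightarrow> (\<Sum>i\<le>degree p. coeff p i * 0)) at_top"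
    by (intro tendsto_intros tendsto_power_div_exp_0)
  then show ?thesis
    by (simp add: poly_altdef sum_distrib_right exp_minus divide_inverse mult.assoc)
qed

text \<open>With y = 1/x one has d/dx = -y^2 d/dy, which sends p(y) exp(-y) to y^2 (p - p')(y)
  exp(-y). At 0 both one-sided difference quotients tend to 0.\<close>

lemma flat_has_derivative:
  "(flat p has_real_derivative flat ([:0, 0, 1:] * (p - pderiv p)) x) (at x)"
proof (cases x "0::real" rule: linorder_cases)
  case less
  have "((\<lambda>_. 0) has_real_derivative 0) (at x)" by simp
  then have "(flat p has_real_derivative 0) (at x)"
    by (rule has_field_derivative_transform_within_open[where S="{..<0}"])
       (use less in \<open>auto simp: flat_def\<close>)
  then show ?thesis using less by (simp add: flat_def)
next
  case greater
  have "((\<lambda>x. poly p (inverse x) * exp (- inverse x)) has_real_derivative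
      flat ([:0, 0, 1:] * (p - pderiv p)) x) (at x)"
    using greater
    by (auto intro!: derivative_eq_intros DERIV_chain'[OF _ poly_DERIV]
             simp: flat_def power2_eq_square algebra_simps)
  then show ?thesis
    by (rule has_field_derivative_transform_within_open[where S="{0<..}"])
       (use greater in \<open>auto simp: flat_def\<close>)
next
  case equal
  have "((\<lambda>h. flat p h / h) \<longlongrightarrow> 0) (at_left 0)"
    by (rule tendsto_eventually) (auto simp: eventually_at_filter flat_def)
  moreover have "((\<lambda>h. flat p h / h) \<longlongrightarrow> 0) (at_right 0)"
  proof -
    \<comment> \<open>The substitution h = 1/y turns the division by h into a factor y, which
      \<open>[:0,1:] * p\<close> absorbs.\<close>
    have "((\<lambda>y. flat p (inverse y) / inverse y) \<longlongrightarrow> 0) at_top"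
    proof (rule Lim_transform_eventually[OF poly_times_exp_minus_tendsto_0[of "[:0,1:] * p"]])
      show "\<forall>\<^sub>F y in at_top. poly ([:0, 1:] * p) y * exp (- y) = flat p (inverse y) / inverse y"
        using eventually_gt_at_top[of 0] by eventually_elim (simp add: flat_def field_simps)
    qed
    then show ?thesis by (subst filterlim_at_right_to_top)
  qed
  ultimately have "((\<lambda>h. flat p h / h) \<longlongrightarrow> 0) (at 0)"
    by (rule filterlim_split_at)
  then show ?thesis using equal by (simp add: DERIV_def flat_def)
qed

text \<open>Sums are included because the product rule turns one product into two.\<close>

inductive_set flat_products :: "real \<Rightarrow> real \<Rightarrow> (real \<Rightarrow> complex) set" for a b where
  prod: "(\<lambda>x. complex_of_real (flat p (x - a) * flat q (b - x))) \<in> flat_products a b"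
| add: "f \<in> flat_products a b \<Longrightarrow> g \<in> flat_products a b \<Longrightarrow> (\<lambda>x. f x + g x) \<in> flat_products a b"

lemma flat_products_derivation_closed:
  assumes "f \<in> flat_products a b"
  shows "\<exists>g\<in>flat_products a b. \<forall>x. (f has_vector_derivative g x) (at x)"
  using assms
proof induction
  case (prod p q)
  let ?d = "\<lambda>p. [:0, 0, 1:] * (p - pderiv p)"
  let ?g = "\<lambda>x. complex_of_real (flat (?d p) (x - a) * flat q (b - x))
    + complex_of_real (flat p (x - a) * flat (- ?d q) (b - x))"
  \<comment> \<open>The inner derivative -1 of b - x is absorbed in the polynomial.\<close>
  have neg: "flat (- ?d q) y = - flat (?d q) y" for y
    by (simp add: flat_def algebra_simps)
  have "((\<lambda>x. flat p (x - a) * flat q (b - x)) has_real_derivative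
      (flat (?d p) (x - a) * flat q (b - x) + flat p (x - a) * flat (- ?d q) (b - x))) (at x)" for x
    unfolding neg
    by (auto intro!: derivative_eq_intros DERIV_chain'[OF _ flat_has_derivative])
  then have "((\<lambda>x. complex_of_real (flat p (x - a) * flat q (b - x))) has_vector_derivative ?g x) (at x)" for x
    unfolding of_real_add[symmetric]
    by (intro has_vector_derivative_of_real) (simp add: has_real_derivative_iff_has_vector_derivative)
  moreover have "?g \<in> flat_products a b"
    by (intro flat_products.intros)
  ultimately show ?case by (intro bexI[of _ ?g] allI)
next
  case (add f g)
  then obtain f' g' where "f' \<in> flat_products a b" "g' \<in> flat_products a b"
    "\<forall>x. (f has_vector_derivative f' x) (at x)" "\<forall>x. (g has_vector_derivative g' x) (at x)"
    by blast
  then show ?case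
    by (intro bexI[of _ "\<lambda>x. f' x + g' x"] allI has_vector_derivative_add flat_products.add) simp_all
qed

lemma exists_bump:
  fixes a b :: real
  obtains \<psi> where "\<And>k x. nth_vderiv k \<psi> differentiable (at x)"
    "\<And>x. \<psi> x \<noteq> 0 \<longleftrightarrow> a < x \<and> x < b"
proof
  \<comment> \<open>This is exp(-1/(x - a)) exp(-1/(b - x)) between a and b, and zero
    elsewhere.\<close>
  let ?\<psi> = "\<lambda>x. complex_of_real (flat 1 (x - a) * flat 1 (b - x))"
  show "?\<psi> x \<noteq> 0 \<longleftrightarrow> a < x \<and> x < b" for x
    by (simp add: flat_def)
  fix k x
  have "nth_vderiv k ?\<psi> \<in> flat_products a b"
    by (rule nth_vderiv_in_derivation_closed[OF flat_products_derivation_closed flat_products.prod])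
  then show "nth_vderiv k ?\<psi> differentiable (at x)"
    using flat_products_derivation_closed differentiableI_vector by blast
qed

section \<open>Test functions\<close>

lemma C0_infinity_has_derivative:
  assumes "f \<in> C0_infinity I"
  shows "(nth_vderiv k f has_vector_derivative nth_vderiv (Suc k) f x) (at x)"
  using assms by (auto simp: C0_infinity_def nth_vderiv_Suc vector_derivative_works[symmetric])

lemma vector_derivative_eq_0_outside_support:
  fixes f :: "real \<Rightarrow> complex"
  assumes "x \<notin> closure {x. f x \<noteq> 0}"
  shows "vector_derivative f (at x) = 0"
proof -
  let ?K = "closure {x. f x \<noteq> 0}"
  have "((\<lambda>_. 0) has_vector_derivative 0) (at x)" by simp
  then have "(f has_vector_derivative 0) (at x)"
  proof (rule has_vector_derivative_transform_within_open[where S="- ?K"])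
    show "0 = f y" if "y \<in> - ?K" for y
      using that closure_subset[of "{x. f x \<noteq> 0}"] by auto
  qed (use assms in \<open>simp_all only: open_Compl closed_closure Compl_iff not_False_eq_True\<close>)
  then show ?thesis by (rule vector_derivative_at)
qed

text \<open>Differentiation cannot enlarge the support, so compactness and the inclusion in
  \<open>I\<close> pass on.\<close>

lemma C0_infinity_nth_vderiv:
  assumes f: "f \<in> C0_infinity I"
  shows "nth_vderiv k f \<in> C0_infinity I"
proof (induction k)
  case (Suc k)
  let ?g = "nth_vderiv k f"
  have "nth_vderiv (Suc k) f x = 0" if "x \<notin> closure {x. ?g x \<noteq> 0}" for x
    using vector_derivative_eq_0_outside_support[OF that] by (simp add: nth_vderiv_Suc)
  then have "{x. nth_vderiv (Suc k) f x \<noteq> 0} \<subseteq> closure {x. ?g x \<noteq> 0}"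
    by auto
  then have sub: "closure {x. nth_vderiv (Suc k) f x \<noteq> 0} \<subseteq> closure {x. ?g x \<noteq> 0}"
    by (rule closure_minimal) simp
  have "compact (closure {x. ?g x \<noteq> 0})"
    using Suc unfolding C0_infinity_def by blast
  then have "compact (closure {x. nth_vderiv (Suc k) f x \<noteq> 0})"
    using closed_closure sub by (metis compact_Int_closed Int_absorb1)
  moreover have "nth_vderiv j (nth_vderiv (Suc k) f) differentiable (at x)" for j x
    using f by (simp add: nth_vderiv_nth_vderiv C0_infinity_def)
  ultimately show ?case
    using Suc sub unfolding C0_infinity_def by blast
qed (use f in auto)

lemma C0_infinity_continuous_on:
  "f \<in> C0_infinity I \<Longrightarrow> continuous_on A (nth_vderiv k f)"
  by (intro continuous_at_imp_continuous_on)
     (auto simp: C0_infinity_def intro: differentiable_imp_continuous_within)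

section \<open>Integration by parts and weak derivatives\<close>

text \<open>Both integrands vanish off the support of \<open>f\<close>, so \<open>I\<close> may be
  exchanged for a compact interval at whose ends \<open>f\<close> is zero; there the fundamental
  theorem applies to the product of \<open>f\<close> and \<open>g\<close>.\<close>

lemma C0_infinity_integral_mult_vderiv:
  assumes "f \<in> C0_infinity I" "g \<in> C0_infinity I"
  shows "(LINT x:I|lborel. f x * nth_vderiv 1 g x) = - (LINT x:I|lborel. nth_vderiv 1 f x * g x)"
proof -
  let ?f' = "nth_vderiv 1 f" and ?g' = "nth_vderiv 1 g"
  let ?K = "closure {x. f x \<noteq> 0}"
  have K: "compact ?K" "?K \<subseteq> I" using assms(1) by (auto simp: C0_infinity_def)
  obtain a where a: "?K \<subseteq> {- a..a}"
  proof -
    obtain a where "\<forall>x\<in>?K. \<bar>x\<bar> \<le> a"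
      using compact_imp_bounded[OF K(1)] by (auto simp: bounded_iff)
    then show ?thesis by (intro that[of a]) (auto simp: abs_le_iff)
  qed
  \<comment> \<open>The summand 1 puts both end points outside the support of \<open>f\<close>; the
    absolute value covers a negative \<open>a\<close>, possible when the support is empty.\<close>
  define M where "M = \<bar>a\<bar> + 1"
  have f0: "f x = 0" if "x \<notin> ?K" for x using that closure_subset[of "{x. f x \<noteq> 0}"] by auto
  have f'0: "?f' x = 0" if "x \<notin> ?K" for x
    using vector_derivative_eq_0_outside_support[OF that] by (simp add: nth_vderiv_Suc)
  have K_M: "x \<in> {-M..M}" if "x \<in> ?K" for x
    using a that by (force simp: M_def)
  \<comment> \<open>The support of \<open>f\<close> lies in both sets, and off it \<open>f\<close>
    and its derivative vanish; \<open>u\<close> stands for the other factor of the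
    integrand.\<close>
  have ind: "indicator I x *\<^sub>R (f x * u) = indicator {-M..M} x *\<^sub>R (f x * u)"
     "indicator I x *\<^sub>R (?f' x * u) = indicator {-M..M} x *\<^sub>R (?f' x * u)" for x u
  proof -
    consider "x \<in> I" "x \<in> {-M..M}" | "f x = 0" "?f' x = 0"
      using K_M K(2) f0 f'0 by blast
    then show "indicator I x *\<^sub>R (f x * u) = indicator {-M..M} x *\<^sub>R (f x * u)"
     "indicator I x *\<^sub>R (?f' x * u) = indicator {-M..M} x *\<^sub>R (?f' x * u)"
      by (cases; simp)+
  qed
  have der: "(f has_vector_derivative ?f' x) (at x)" "(g has_vector_derivative ?g' x) (at x)" for x
    using C0_infinity_has_derivative[OF assms(1), of 0] C0_infinity_has_derivative[OF assms(2), of 0]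
    by auto
  have cont: "continuous_on A f" "continuous_on A g" "continuous_on A ?f'" "continuous_on A ?g'" for A
    using C0_infinity_continuous_on[OF assms(1), of A 0] C0_infinity_continuous_on[OF assms(2), of A 0]
      C0_infinity_continuous_on[OF assms(1)] C0_infinity_continuous_on[OF assms(2)] by auto
  have int: "integrable lborel (\<lambda>x. indicator {-M..M} x *\<^sub>R (f x * ?g' x))"
    "integrable lborel (\<lambda>x. indicator {-M..M} x *\<^sub>R (?f' x * g x))"
    by (intro borel_integrable_compact continuous_intros cont; simp)+
  have "has_bochner_integral lborel (\<lambda>x. indicator {-M..M} x *\<^sub>R (f x * ?g' x + ?f' x * g x))
      (f M * g M - f (-M) * g (-M))"
  proof (rule has_bochner_integral_FTC_Icc[where F="\<lambda>x. f x * g x"])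
    show "- M \<le> M" using abs_ge_zero[of a] unfolding M_def by linarith
    show "((\<lambda>x. f x * g x) has_vector_derivative f x * ?g' x + ?f' x * g x) (at x within {-M..M})" for x
      by (rule has_vector_derivative_at_within[OF has_vector_derivative_mult[OF der]])
    show "continuous_on {-M..M} (\<lambda>x. f x * ?g' x + ?f' x * g x)"
      by (intro continuous_intros cont)
  qed
  moreover have "f M = 0" "f (-M) = 0"
    using a by (force intro!: f0 simp: M_def)+
  ultimately have "(LBINT x. indicator {-M..M} x *\<^sub>R (f x * ?g' x + ?f' x * g x)) = 0"
    by (auto dest: has_bochner_integral_integral_eq)
  then show ?thesis
    using int unfolding set_lebesgue_integral_def ind
    by (simp add: scaleR_add_right eq_neg_iff_add_eq_0)
qed

text \<open>One derivative at a time moves onto \<open>f\<close>, which therefore varies in the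
  induction; each move costs a sign.\<close>

lemma C0_infinity_integral_mult_nth_vderiv:
  assumes "f \<in> C0_infinity I" "\<phi> \<in> C0_infinity I"
  shows "(LINT x:I|lborel. f x * nth_vderiv k \<phi> x)
       = (-1) ^ k * (LINT x:I|lborel. nth_vderiv k f x * \<phi> x)"
  using assms(1)
proof (induction k arbitrary: f)
  case (Suc k)
  have "(LINT x:I|lborel. f x * nth_vderiv (Suc k) \<phi> x)
      = - (LINT x:I|lborel. nth_vderiv 1 f x * nth_vderiv k \<phi> x)"
    using C0_infinity_integral_mult_vderiv[OF Suc.prems C0_infinity_nth_vderiv[OF assms(2), of k]]
    by (simp add: nth_vderiv_nth_vderiv)
  also have "\<dots> = - ((-1) ^ k * (LINT x:I|lborel. nth_vderiv k (nth_vderiv 1 f) x * \<phi> x))"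
    using Suc.IH[OF C0_infinity_nth_vderiv[OF Suc.prems]] by simp
  finally show ?case by (simp add: nth_vderiv_nth_vderiv)
qed auto

lemma C0_infinity_weak_deriv:
  assumes "f \<in> C0_infinity I"
  shows "weak_deriv_on I k f (nth_vderiv k f)"
  using C0_infinity_integral_mult_nth_vderiv[OF assms] C0_infinity_continuous_on[OF assms, of _ 0]
    C0_infinity_continuous_on[OF assms]
  by (auto simp: weak_deriv_on_def locally_integrable_on_def set_integrable_def
      intro!: borel_integrable_compact)

text \<open>The constant sequence \<open>f\<close> is an approximating sequence for itself.\<close>

lemma C0_infinity_subset_H0_dot: "C0_infinity I \<subseteq> H0_dot m \<alpha> I"
proof
  fix f assume "f \<in> C0_infinity I"
  then show "f \<in> H0_dot m \<alpha> I"
    unfolding H0_dot_def using C0_infinity_weak_deriv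
    by (intro CollectI exI[of _ "nth_vderiv m f"] exI[of _ "\<lambda>_. f"])
       (auto simp: set_lebesgue_integral_def)
qed

section \<open>Cut-off powers\<close>

text \<open>With \<open>f(x) = x\<^sup>z \<psi>(\<delta> ln (x / \<rho>))\<close>, the derivative \<open>f\<^sup>(\<^sup>k\<^sup>)\<close> is \<open>x\<^sup>z\<^sup>-\<^sup>k\<close> times the function
  \<open>cutoff_deriv z \<psi> k 0 \<delta>\<close> of \<open>\<delta> ln (x / \<rho>)\<close>; the argument \<open>r\<close> counts further derivatives of that function.\<close>

primrec cutoff_deriv :: "complex \<Rightarrow> (real \<Rightarrow> complex) \<Rightarrow> nat \<Rightarrow> nat \<Rightarrow> real \<Rightarrow> real \<Rightarrow> complex" where
  "cutoff_deriv z \<psi> 0 r \<delta> s = nth_vderiv r \<psi> s"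
| "cutoff_deriv z \<psi> (Suc k) r \<delta> s =
     (z - of_nat k) * cutoff_deriv z \<psi> k r \<delta> s + of_real \<delta> * cutoff_deriv z \<psi> k (Suc r) \<delta> s"

definition cutoff_power ::
    "complex \<Rightarrow> (real \<Rightarrow> complex) \<Rightarrow> real \<Rightarrow> real \<Rightarrow> nat \<Rightarrow> real \<Rightarrow> complex" where
  "cutoff_power z \<psi> \<rho> \<delta> k x = (if x > 0 then
     exp ((z - of_nat k) * of_real (ln x)) * cutoff_deriv z \<psi> k 0 \<delta> (\<delta> * (ln x - ln \<rho>)) else 0)"

text \<open>The position of the support decides where the cut-off power lives: a > 0 puts it to the
  right of \<rho>, b < 0 between 0 and \<rho>.\<close>

locale bump =
  fixes \<psi> :: "real \<Rightarrow> complex" and a b :: real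
  assumes less: "a < b"
    and smooth: "\<And>k x. nth_vderiv k \<psi> differentiable (at x)"
    and nonzero_iff: "\<And>x. \<psi> x \<noteq> 0 \<longleftrightarrow> a < x \<and> x < b"
begin

lemma C0: "\<psi> \<in> C0_infinity {a..b}"
proof -
  have "closure {x. \<psi> x \<noteq> 0} = {a..b}"
    using closure_greaterThanLessThan[OF less] unfolding nonzero_iff
    by (simp add: greaterThanLessThan_def greaterThan_def lessThan_def Int_def)
  then show ?thesis using smooth by (simp add: C0_infinity_def del: compact_closure)
qed

lemma nth_vderiv_eq_0: "s \<notin> {a..b} \<Longrightarrow> nth_vderiv r \<psi> s = 0"
  using C0_infinity_nth_vderiv[OF C0, of r] closure_subset[of "{x. nth_vderiv r \<psi> x \<noteq> 0}"]
  unfolding C0_infinity_def by blast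

lemma cutoff_deriv_eq_0: "s \<notin> {a..b} \<Longrightarrow> cutoff_deriv z \<psi> k r \<delta> s = 0"
  by (induction k arbitrary: r) (simp_all add: nth_vderiv_eq_0)

text \<open>At \<delta> = 0 the terms that differentiate the cut-off drop out, and the recursion
  only multiplies by z - k.\<close>

lemma cutoff_deriv_at_0: "cutoff_deriv z \<psi> k r 0 s = (\<Prod>i<k. z - of_nat i) * nth_vderiv r \<psi> s"
  by (induction k) auto

text \<open>Continuity in both variables jointly allows the limit \<delta> to 0 under the integral
  over s.\<close>

lemma continuous_on_cutoff_deriv:
  "continuous_on UNIV (\<lambda>(\<delta>, s). cutoff_deriv z \<psi> k r \<delta> s)"
proof (induction k arbitrary: r)
  case 0
  have "continuous_on UNIV (\<lambda>p::real \<times> real. nth_vderiv r \<psi> (snd p))"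
    by (rule continuous_on_compose2[OF C0_infinity_continuous_on[OF C0, of UNIV]])
       (auto intro: continuous_intros)
  then show ?case by (simp add: case_prod_beta)
next
  case (Suc k)
  show ?case
    using Suc[of r] Suc[of "Suc r"]
    by (auto simp: case_prod_beta intro!: continuous_intros)
qed

lemma cutoff_deriv_has_derivative:
  "(cutoff_deriv z \<psi> k r \<delta> has_vector_derivative cutoff_deriv z \<psi> k (Suc r) \<delta> s) (at s)"
proof (induction k arbitrary: r)
  case 0
  have "cutoff_deriv z \<psi> 0 r \<delta> = nth_vderiv r \<psi>" by auto
  then show ?case using C0_infinity_has_derivative[OF C0] by simp
next
  case (Suc k)
  have "cutoff_deriv z \<psi> (Suc k) r \<delta> =
    (\<lambda>s. (z - of_nat k) * cutoff_deriv z \<psi> k r \<delta> s + of_real \<delta> * cutoff_deriv z \<psi> k (Suc r) \<delta> s)"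
    by auto
  then show ?case
    by (simp only: cutoff_deriv.simps)
       (rule has_vector_derivative_add[OF has_vector_derivative_mult_right[OF Suc]
          has_vector_derivative_mult_right[OF Suc]])
qed

text \<open>The bounds on x are the condition that \<delta> ln(x / \<rho>) lies in [a, b], solved
  for x.\<close>

lemma cutoff_power_eq_0:
  assumes "\<delta> > 0" "\<rho> > 0" "x \<notin> {\<rho> * exp (a / \<delta>)..\<rho> * exp (b / \<delta>)}"
  shows "cutoff_power z \<psi> \<rho> \<delta> k x = 0"
proof (cases "x > 0")
  case True
  have "\<delta> * (ln x - ln \<rho>) \<notin> {a..b}"
  proof
    assume *: "\<delta> * (ln x - ln \<rho>) \<in> {a..b}"
    have "ln \<rho> + a / \<delta> \<le> ln x" "ln x \<le> ln \<rho> + b / \<delta>"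
      using * \<open>\<delta> > 0\<close> by (auto simp: field_simps)
    then have "exp (ln \<rho> + a / \<delta>) \<le> exp (ln x)" "exp (ln x) \<le> exp (ln \<rho> + b / \<delta>)"
      by (simp_all only: exp_le_cancel_iff)
    then show False
      using assms True by (simp add: exp_add)
  qed
  then show ?thesis by (simp add: cutoff_power_def cutoff_deriv_eq_0)
qed (simp add: cutoff_power_def)

text \<open>For x > 0, differentiating x^(z-k) c(\<delta> ln(x / \<rho>)) gives x^(z-k-1) times (z -
  k) c + \<delta> c', which is the recursion of \<open>cutoff_deriv\<close>. For x \<le> 0 the
  function vanishes near x, since its support starts at a positive point.\<close>

lemma cutoff_power_has_derivative:
  assumes "\<delta> > 0" "\<rho> > 0"
  shows "(cutoff_power z \<psi> \<rho> \<delta> k has_vector_derivative cutoff_power z \<psi> \<rho> \<delta> (Suc k) x) (at x)"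
proof (cases "x > 0")
  case True
  let ?w = "z - of_nat k" and ?c = "\<lambda>j r x. cutoff_deriv z \<psi> j r \<delta> (\<delta> * (ln x - ln \<rho>))"
  have "((\<lambda>x. complex_of_real (ln x)) has_vector_derivative of_real (1 / x)) (at x)"
    using True by (intro has_vector_derivative_of_real)
      (auto simp: has_real_derivative_iff_has_vector_derivative[symmetric] intro!: derivative_eq_intros)
  moreover have "((\<lambda>u. exp (?w * u)) has_field_derivative ?w * exp (?w * of_real (ln x)))
      (at (complex_of_real (ln x)))"
    by (auto intro!: derivative_eq_intros)
  ultimately have 1: "((\<lambda>x. exp (?w * of_real (ln x))) has_vector_derivative
      of_real (1 / x) * (?w * exp (?w * of_real (ln x)))) (at x)"
    using field_vector_diff_chain_at[of "\<lambda>x. complex_of_real (ln x)" _ x "\<lambda>u. exp (?w * u)"]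
    by (simp only: o_def)
  have "((\<lambda>x. \<delta> * (ln x - ln \<rho>)) has_vector_derivative \<delta> / x) (at x)"
    using True
    by (auto simp: has_real_derivative_iff_has_vector_derivative[symmetric] intro!: derivative_eq_intros)
  from vector_diff_chain_at[OF this cutoff_deriv_has_derivative]
  have 2: "(?c k 0 has_vector_derivative (\<delta> / x) *\<^sub>R ?c k 1 x) (at x)"
    by (simp add: o_def)
  \<comment> \<open>The factor 1/x produced by both chain rules lowers the exponent of the power by
    one.\<close>
  have "exp ((z - of_nat (Suc k)) * of_real (ln x))
      = exp (?w * of_real (ln x)) * exp (- of_real (ln x))"
    by (simp add: exp_add[symmetric] algebra_simps)
  also have "exp (- complex_of_real (ln x)) = of_real (1 / x)"
    using True by (simp add: exp_minus exp_of_real inverse_eq_divide)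
  finally have *: "cutoff_power z \<psi> \<rho> \<delta> (Suc k) x =
      exp (?w * of_real (ln x)) * ((\<delta> / x) *\<^sub>R ?c k 1 x)
      + of_real (1 / x) * (?w * exp (?w * of_real (ln x))) * ?c k 0 x"
    using True unfolding cutoff_power_def
    by (simp add: scaleR_conv_of_real algebra_simps)
  show ?thesis
    unfolding *
    by (rule has_vector_derivative_transform_within_open[OF has_vector_derivative_mult[OF 1 2],
          where S="{0<..}"])
       (use True in \<open>auto simp: cutoff_power_def\<close>)
next
  case False
  have *: "cutoff_power z \<psi> \<rho> \<delta> j y = 0" if "y < \<rho> * exp (a / \<delta>)" for j y
    using that assms by (intro cutoff_power_eq_0) auto
  have pos: "0 < \<rho> * exp (a / \<delta>)" using assms by simp
  have "((\<lambda>_. 0) has_vector_derivative 0) (at x)" by simp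
  then have "(cutoff_power z \<psi> \<rho> \<delta> k has_vector_derivative 0) (at x)"
    by (rule has_vector_derivative_transform_within_open[where S="{..<\<rho> * exp (a / \<delta>)}"])
       (use False pos * in auto)
  then show ?thesis using False pos * by simp
qed

lemma nth_vderiv_cutoff_power:
  assumes "\<delta> > 0" "\<rho> > 0"
  shows "nth_vderiv k (cutoff_power z \<psi> \<rho> \<delta> 0) = cutoff_power z \<psi> \<rho> \<delta> k"
  by (rule nth_vderiv_eqI) (rule cutoff_power_has_derivative[OF assms])

lemma cutoff_power_C0:
  assumes "\<delta> > 0" "\<rho> > 0" "{\<rho> * exp (a / \<delta>)..\<rho> * exp (b / \<delta>)} \<subseteq> I"
  shows "cutoff_power z \<psi> \<rho> \<delta> 0 \<in> C0_infinity I"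
proof -
  let ?S = "{x. cutoff_power z \<psi> \<rho> \<delta> 0 x \<noteq> 0}"
  let ?J = "{\<rho> * exp (a / \<delta>)..\<rho> * exp (b / \<delta>)}"
  have "?S \<subseteq> ?J" using cutoff_power_eq_0[OF assms(1,2)] by blast
  then have sub: "closure ?S \<subseteq> ?J" by (rule closure_minimal) simp
  then have "compact (closure ?S)"
    using closed_closure by (metis compact_Icc compact_Int_closed Int_absorb1)
  moreover have "nth_vderiv k (cutoff_power z \<psi> \<rho> \<delta> 0) differentiable (at x)" for k x
    using cutoff_power_has_derivative[OF assms(1,2)]
    by (auto simp: nth_vderiv_cutoff_power[OF assms(1,2)] intro: differentiableI_vector)
  ultimately show ?thesis using sub assms(3) by (auto simp: C0_infinity_def)
qed

text \<open>The condition on \<beta> makes the weight times the squared modulus of x^(z-k) equal to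
  1/x, and s = \<delta> ln(x / \<rho>) turns dx/x into ds/\<delta>.\<close>

lemma cutoff_power_integral:
  assumes "\<delta> > 0" "\<rho> > 0" and I: "{\<rho> * exp (a / \<delta>)..\<rho> * exp (b / \<delta>)} \<subseteq> I"
    and \<beta>: "\<beta> + 2 * (Re z - real k) = - 1"
  shows "(LINT x:I|lborel. x powr \<beta> * (cmod (cutoff_power z \<psi> \<rho> \<delta> k x))\<^sup>2)
       = integral {a..b} (\<lambda>s. (cmod (cutoff_deriv z \<psi> k 0 \<delta> s))\<^sup>2) / \<delta>"
proof -
  let ?p = "\<rho> * exp (a / \<delta>)" and ?q = "\<rho> * exp (b / \<delta>)"
  let ?g = "\<lambda>x. \<delta> * (ln x - ln \<rho>)"
  let ?h = "\<lambda>s. (cmod (cutoff_deriv z \<psi> k 0 \<delta> s))\<^sup>2"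
  have pos: "0 < ?p" using assms by simp
  have ends: "?g ?p = a" "?g ?q = b"
    using assms by (simp_all add: ln_mult)
  have cont: "continuous_on A ?h" for A
    by (intro continuous_intros differentiable_imp_continuous_on)
       (auto simp: differentiable_on_def
         intro: differentiableI_vector has_vector_derivative_at_within cutoff_deriv_has_derivative)
  have int: "set_integrable lborel {a..b} ?h"
    unfolding set_integrable_def by (intro borel_integrable_compact cont) simp
  \<comment> \<open>The factor \<delta> / x is the derivative of the substitution \<open>?g\<close>;
    dividing by \<delta> compensates.\<close>
  have "indicator I x *\<^sub>R (x powr \<beta> * (cmod (cutoff_power z \<psi> \<rho> \<delta> k x))\<^sup>2)
      = (?h (?g x) * (\<delta> / x) * indicator {?p..?q} x) / \<delta>" for x
  proof (cases "x \<in> {?p..?q}")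
    case True
    then have x: "x > 0" "x \<in> I" using pos I by auto
    \<comment> \<open>The imaginary part of z contributes only a factor of modulus one, so the
      exponent involves Re z alone.\<close>
    have "\<beta> * ln x + (Re z - real k) * ln x + (Re z - real k) * ln x
        = (\<beta> + 2 * (Re z - real k)) * ln x"
      by (simp add: algebra_simps)
    then have "x powr \<beta> * (exp ((Re z - real k) * ln x))\<^sup>2 = exp (- ln x)"
      using x unfolding \<beta> by (simp add: powr_def power2_eq_square mult_exp_exp add.assoc)
    then show ?thesis
      using True x \<open>\<delta> > 0\<close>
      by (simp add: cutoff_power_def norm_mult power_mult_distrib exp_minus mult.assoc[symmetric]
           inverse_eq_divide)
  qed (simp add: cutoff_power_eq_0[OF assms(1,2)])
  then have "(LINT x:I|lborel. x powr \<beta> * (cmod (cutoff_power z \<psi> \<rho> \<delta> k x))\<^sup>2)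
      = (LBINT x. ?h (?g x) * (\<delta> / x) * indicator {?p..?q} x) / \<delta>"
    by (simp only: set_lebesgue_integral_def integral_divide_zero)
  also have "(LBINT x. ?h (?g x) * (\<delta> / x) * indicator {?p..?q} x)
      = (LBINT x. ?h x * indicator {?g ?p..?g ?q} x)"
  proof (rule integral_substitution(2)[symmetric])
    show "set_integrable lborel {?g ?p..?g ?q} ?h" using int by (simp only: ends)
    show "(?g has_real_derivative \<delta> / x) (at x)" "0 \<le> \<delta> / x" if "x \<in> {?p..?q}" for x
      using that pos \<open>\<delta> > 0\<close> by (auto intro!: derivative_eq_intros)
    show "continuous_on {?p..?q} (\<lambda>x. \<delta> / x)"
      using pos by (intro continuous_intros) auto
    show "?p \<le> ?q"
      using assms less by (simp add: divide_right_mono)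
  qed
  also have "\<dots> = integral {a..b} ?h"
    unfolding ends using set_borel_integral_eq_integral(2)[OF int]
    by (simp add: set_lebesgue_integral_def mult.commute)
  finally show ?thesis .
qed

text \<open>The transformed integral makes sense at \<delta> = 0 too, so its limit as \<delta>
  decreases to 0 is its value there.\<close>

lemma continuous_on_integral_cutoff_deriv:
  "continuous_on UNIV (\<lambda>\<delta>. integral {a..b} (\<lambda>s. (cmod (cutoff_deriv z \<psi> k 0 \<delta> s))\<^sup>2))"
proof -
  have "continuous_on (UNIV \<times> cbox a b) (\<lambda>(\<delta>, s). (cmod (cutoff_deriv z \<psi> k 0 \<delta> s))\<^sup>2)"
    using continuous_on_subset[OF continuous_on_cutoff_deriv[of z k 0]]
    by (auto simp: case_prod_beta intro!: continuous_intros)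
  from integral_continuous_on_param[OF this] show ?thesis by simp
qed

text \<open>In the limit the order k enters only through the product in front; the integral of the
  bump is common to all orders.\<close>

lemma integral_cutoff_deriv_at_0:
  "integral {a..b} (\<lambda>s. (cmod (cutoff_deriv z \<psi> k 0 0 s))\<^sup>2)
     = (cmod (\<Prod>i<k. z - of_nat i))\<^sup>2 * integral {a..b} (\<lambda>s. (cmod (\<psi> s))\<^sup>2)"
  by (simp add: cutoff_deriv_at_0 norm_mult power_mult_distrib)

text \<open>A continuous nonnegative function with zero integral vanishes identically, but the bump
  is nonzero at the midpoint.\<close>

lemma integral_pos: "0 < integral {a..b} (\<lambda>s. (cmod (\<psi> s))\<^sup>2)"
proof -
  have cont: "continuous_on {a..b} (\<lambda>s. (cmod (\<psi> s))\<^sup>2)"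
    using C0_infinity_continuous_on[OF C0, of _ 0] by (auto intro!: continuous_intros)
  have "\<psi> ((a + b) / 2) \<noteq> 0" "(a + b) / 2 \<in> {a..b}" using less by (auto simp: nonzero_iff)
  then have "integral {a..b} (\<lambda>s. (cmod (\<psi> s))\<^sup>2) \<noteq> 0"
    using integral_eq_0_iff[OF cont less] by force
  moreover have "0 \<le> integral {a..b} (\<lambda>s. (cmod (\<psi> s))\<^sup>2)"
    by (intro integral_nonneg integrable_continuous_real cont) auto
  ultimately show ?thesis by simp
qed

end

section \<open>Near-extremal test functions\<close>

text \<open>The gap between \<open>A_const l \<alpha>\<close> and C leaves room for a positive
  imaginary part \<epsilon> of z: the product is continuous in \<epsilon>, with value
  \<open>A_const l \<alpha>\<close> at 0.\<close>

lemma perturbed_A_const: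
  assumes "C > A_const l \<alpha>"
  obtains \<epsilon> where "\<epsilon> > 0" "(\<Prod>j=1..l. ((2 * real j - 1 - \<alpha>) / 2)\<^sup>2 + \<epsilon>\<^sup>2) < C"
proof -
  let ?P = "\<lambda>\<epsilon>::real. \<Prod>j=1..l. ((2 * real j - 1 - \<alpha>) / 2)\<^sup>2 + \<epsilon>\<^sup>2"
  have "(?P \<longlongrightarrow> (\<Prod>j=1..l. ((2 * real j - 1 - \<alpha>) / 2)\<^sup>2 + 0\<^sup>2)) (at_right 0)"
    by (intro tendsto_intros)
  then have "(?P \<longlongrightarrow> A_const l \<alpha>) (at_right 0)"
    by (simp add: A_const_def)
  then have "eventually (\<lambda>\<epsilon>. ?P \<epsilon> < C) (at_right 0)"
    using assms by (rule order_tendstoD)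
  then have "eventually (\<lambda>\<epsilon>. 0 < \<epsilon> \<and> ?P \<epsilon> < C) (at_right 0)"
    by (intro eventually_conj eventually_at_right_less)
  then obtain \<epsilon> where "0 < \<epsilon> \<and> ?P \<epsilon> < C"
    using eventually_happens trivial_limit_at_right_real by blast
  then show ?thesis using that by blast
qed

text \<open>For i = m - j the real part of z - i is (2j - 1 - \<alpha>)/2, so the top l factors give
  the perturbed constant and the remaining m - l are shared.\<close>

lemma norm_falling_product:
  fixes l m :: nat and \<alpha> \<epsilon> :: real
  assumes "l \<le> m"
  defines "z \<equiv> Complex (real m - (1 + \<alpha>) / 2) \<epsilon>"
  shows "(cmod (\<Prod>i<m. z - of_nat i))\<^sup>2
    = (cmod (\<Prod>i<m - l. z - of_nat i))\<^sup>2 * (\<Prod>j=1..l. ((2 * real j - 1 - \<alpha>) / 2)\<^sup>2 + \<epsilon>\<^sup>2)"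
proof -
  have "(\<Prod>i<m. (cmod (z - of_nat i))\<^sup>2)
      = (\<Prod>i<m - l. (cmod (z - of_nat i))\<^sup>2) * (\<Prod>i\<in>{m - l..<m}. (cmod (z - of_nat i))\<^sup>2)"
    using assms by (subst prod.union_disjoint[symmetric]) (auto intro!: prod.cong)
  also have "(\<Prod>i\<in>{m - l..<m}. (cmod (z - of_nat i))\<^sup>2)
      = (\<Prod>j=1..l. ((2 * real j - 1 - \<alpha>) / 2)\<^sup>2 + \<epsilon>\<^sup>2)"
  proof (rule prod.reindex_bij_witness[of _ "\<lambda>j. m - j" "\<lambda>i. m - i"])
    fix i assume i: "i \<in> {m - l..<m}"
    have "Re (z - of_nat i) = (2 * real (m - i) - 1 - \<alpha>) / 2" "Im (z - of_nat i) = \<epsilon>"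
      using i by (auto simp: z_def of_nat_diff field_simps)
    then show "((2 * real (m - i) - 1 - \<alpha>) / 2)\<^sup>2 + \<epsilon>\<^sup>2 = (cmod (z - of_nat i))\<^sup>2"
      by (simp only: cmod_power2)
  qed (use assms in auto)
  finally show ?thesis
    by (simp add: prod_norm[symmetric] prod_power_distrib)
qed

lemma exists_near_extremal:
  assumes "l \<le> m" "\<rho> > 0" and I: "I = {0<..<\<rho>} \<or> I = {\<rho><..}" and C: "C > A_const l \<alpha>"
  shows "\<exists>f\<in>C0_infinity I. (LINT x:I|lborel. x powr \<alpha> * (cmod (nth_vderiv m f x))\<^sup>2)
    < C * (LINT x:I|lborel. x powr (\<alpha> - 2 * real l) * (cmod (nth_vderiv (m - l) f x))\<^sup>2)"
proof -
  \<comment> \<open>The sign of the bump's support is fixed here, so that the cut-off power stays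
    inside \<open>I\<close> for every \<delta> > 0.\<close>
  obtain a b :: real where ab: "a < b" "I = {0<..<\<rho>} \<and> b < 0 \<or> I = {\<rho><..} \<and> 0 < a"
    using I
  proof
    assume "I = {0<..<\<rho>}"
    then show thesis by (intro that[of "-2" "-1"]) auto
  next
    assume "I = {\<rho><..}"
    then show thesis by (intro that[of 1 2]) auto
  qed
  obtain \<psi> where "\<And>k x. nth_vderiv k \<psi> differentiable (at x)"
    "\<And>x. \<psi> x \<noteq> 0 \<longleftrightarrow> a < x \<and> x < b"
    using exists_bump by blast
  then interpret bump \<psi> a b using ab by unfold_locales
  obtain \<epsilon> where \<epsilon>: "\<epsilon> > 0" "(\<Prod>j=1..l. ((2 * real j - 1 - \<alpha>) / 2)\<^sup>2 + \<epsilon>\<^sup>2) < C"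
    using perturbed_A_const[OF C] .
  \<comment> \<open>This real part is critical for both integrals: passing from order m to m - l
    raises 2(Re z - k) by 2l, which the weight exponent \<alpha> - 2l offsets.\<close>
  define z where "z = Complex (real m - (1 + \<alpha>) / 2) \<epsilon>"
  define J where "J k \<delta> = integral {a..b} (\<lambda>s. (cmod (cutoff_deriv z \<psi> k 0 \<delta> s))\<^sup>2)" for k \<delta>
  \<comment> \<open>As z is not real, the common factors are nonzero and the strict inequality for
    the constants survives multiplication by them.\<close>
  have "z \<noteq> of_nat i" for i
    using \<epsilon> by (auto simp: z_def complex_eq_iff)
  then have "0 < (cmod (\<Prod>i<m - l. z - of_nat i))\<^sup>2" by simp
  then have "J m 0 < C * J (m - l) 0"
    using \<epsilon> integral_pos norm_falling_product[OF \<open>l \<le> m\<close>, of \<alpha> \<epsilon>]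
    by (simp add: J_def integral_cutoff_deriv_at_0 z_def[symmetric])
  moreover have "continuous_on UNIV (J k)" for k
    using continuous_on_integral_cutoff_deriv[of z k] by (simp add: J_def[abs_def])
  then have "isCont (J k) 0" for k
    by (simp add: continuous_on_eq_continuous_at)
  \<comment> \<open>The strict inequality at \<delta> = 0 persists for small positive \<delta>;
    working with the difference avoids a quotient.\<close>
  then have "((\<lambda>\<delta>. C * J (m - l) \<delta> - J m \<delta>) \<longlongrightarrow> C * J (m - l) 0 - J m 0) (at_right 0)"
    by (intro tendsto_intros) (auto simp: isCont_def intro: filterlim_at_split[THEN iffD1, THEN conjunct2])
  ultimately have "eventually (\<lambda>\<delta>. 0 < C * J (m - l) \<delta> - J m \<delta>) (at_right 0)"
    by (intro order_tendstoD) auto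
  then have "eventually (\<lambda>\<delta>. 0 < \<delta> \<and> 0 < C * J (m - l) \<delta> - J m \<delta>) (at_right 0)"
    by (intro eventually_conj eventually_at_right_less)
  then obtain \<delta> where \<delta>: "\<delta> > 0" "J m \<delta> < C * J (m - l) \<delta>"
    using eventually_happens[of _ "at_right (0::real)"] by force
  have sub: "{\<rho> * exp (a / \<delta>)..\<rho> * exp (b / \<delta>)} \<subseteq> I"
    using ab(2)
  proof (elim disjE conjE)
    assume *: "I = {0<..<\<rho>}" "b < 0"
    have "0 < \<rho> * exp (a / \<delta>)" "\<rho> * exp (b / \<delta>) < \<rho>"
      using * \<delta> \<open>\<rho> > 0\<close> by (auto simp: divide_neg_pos)
    then show ?thesis using * by auto
  next
    assume *: "I = {\<rho><..}" "0 < a"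
    have "\<rho> < \<rho> * exp (a / \<delta>)"
      using * \<delta> \<open>\<rho> > 0\<close> by auto
    then show ?thesis using * by auto
  qed
  have "(LINT x:I|lborel. x powr \<alpha> * (cmod (cutoff_power z \<psi> \<rho> \<delta> m x))\<^sup>2) = J m \<delta> / \<delta>"
    unfolding J_def using \<delta> \<open>\<rho> > 0\<close>
    by (intro cutoff_power_integral sub) (auto simp: z_def field_simps)
  moreover have "(LINT x:I|lborel. x powr (\<alpha> - 2 * real l) * (cmod (cutoff_power z \<psi> \<rho> \<delta> (m - l) x))\<^sup>2)
      = J (m - l) \<delta> / \<delta>"
    unfolding J_def using \<delta> \<open>\<rho> > 0\<close> \<open>l \<le> m\<close>
    by (intro cutoff_power_integral sub) (auto simp: z_def of_nat_diff field_simps)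
  ultimately show ?thesis
    using \<delta> cutoff_power_C0[OF \<open>\<delta> > 0\<close> \<open>\<rho> > 0\<close> sub]
    by (intro bexI[of _ "cutoff_power z \<psi> \<rho> \<delta> 0"])
       (simp_all add: nth_vderiv_cutoff_power \<open>\<rho> > 0\<close> divide_strict_right_mono)
qed

section \<open>The logarithmic weights\<close>

text \<open>The integrand lives on a compact subset of \<open>I\<close>, so a weight that is
  singular at the end points does no harm.\<close>

lemma C0_infinity_weighted_integrable:
  assumes f: "f \<in> C0_infinity I" and V: "continuous_on I V"
  shows "set_integrable lborel I (\<lambda>x. V x * (cmod (f x))\<^sup>2)"
proof -
  let ?K = "closure {x. f x \<noteq> 0}"
  have K: "compact ?K" "?K \<subseteq> I" using f unfolding C0_infinity_def by blast+
  have "integrable lborel (\<lambda>x. indicator ?K x *\<^sub>R (V x * (cmod (f x))\<^sup>2))"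
    using C0_infinity_continuous_on[OF f, of ?K 0] continuous_on_subset[OF V K(2)] K(1)
    by (intro borel_integrable_compact continuous_intros) auto
  also have "(\<lambda>x. indicator ?K x *\<^sub>R (V x * (cmod (f x))\<^sup>2))
      = (\<lambda>x. indicator I x *\<^sub>R (V x * (cmod (f x))\<^sup>2))"
  proof
    fix x
    show "indicator ?K x *\<^sub>R (V x * (cmod (f x))\<^sup>2) = indicator I x *\<^sub>R (V x * (cmod (f x))\<^sup>2)"
    proof (cases "f x = 0")
      case False
      then have "x \<in> ?K" using closure_subset[of "{x. f x \<noteq> 0}"] by blast
      then show ?thesis using K(2) by auto
    qed simp
  qed
  finally show ?thesis by (simp add: set_integrable_def)
qed

text \<open>A nonnegative \<open>W\<close> only enlarges the right-hand side for the near-extremal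
  function. Continuity of \<open>W\<close> secures integrability: a divergent integral would have
  the default value 0, and monotonicity could fail.\<close>

lemma not_weighted_ineq:
  assumes "l \<le> m" "\<rho> > 0" and I: "I = {0<..<\<rho>} \<or> I = {\<rho><..}" and C: "C > A_const l \<alpha>"
    and W: "continuous_on I W" "\<And>x. 0 \<le> W x"
  shows "\<not> weighted_ineq_C0 I m l \<alpha> (\<lambda>x. C + W x) \<and> \<not> weighted_ineq_H0 I m l \<alpha> (\<lambda>x. C + W x)"
proof -
  obtain f where f: "f \<in> C0_infinity I"
    and less: "(LINT x:I|lborel. x powr \<alpha> * (cmod (nth_vderiv m f x))\<^sup>2)
      < C * (LINT x:I|lborel. x powr (\<alpha> - 2 * real l) * (cmod (nth_vderiv (m - l) f x))\<^sup>2)"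
    using exists_near_extremal[OF assms(1-4)] by blast
  let ?h = "nth_vderiv (m - l) f" and ?v = "\<lambda>x. x powr (\<alpha> - 2 * real l)"
  have "I \<subseteq> {0<..}" using I \<open>\<rho> > 0\<close> by auto
  then have v: "continuous_on I ?v"
    by (intro continuous_intros) auto
  note int = C0_infinity_weighted_integrable[OF C0_infinity_nth_vderiv[OF f, of "m - l"]]
  have "C * (LINT x:I|lborel. ?v x * (cmod (?h x))\<^sup>2) = (LINT x:I|lborel. ?v x * C * (cmod (?h x))\<^sup>2)"
    unfolding set_integral_mult_right[symmetric] by (simp only: ac_simps)
  also have "\<dots> \<le> (LINT x:I|lborel. ?v x * (C + W x) * (cmod (?h x))\<^sup>2)"
  proof (rule set_integral_mono)
    show "set_integrable lborel I (\<lambda>x. ?v x * C * (cmod (?h x))\<^sup>2)"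
      by (intro int continuous_on_mult continuous_on_const v)
    show "set_integrable lborel I (\<lambda>x. ?v x * (C + W x) * (cmod (?h x))\<^sup>2)"
      by (intro int continuous_on_mult continuous_on_add continuous_on_const v W)
    show "?v x * C * (cmod (?h x))\<^sup>2 \<le> ?v x * (C + W x) * (cmod (?h x))\<^sup>2" for x
      using W(2)[of x] by (intro mult_right_mono mult_left_mono) auto
  qed
  finally have *: "\<not> (LINT x:I|lborel. x powr \<alpha> * (cmod (nth_vderiv m f x))\<^sup>2)
      \<ge> (LINT x:I|lborel. ?v x * (C + W x) * (cmod (?h x))\<^sup>2)"
    using less by linarith
  \<comment> \<open>The same function refutes both inequalities, its classical derivatives serving
    as weak ones.\<close>
  moreover have "f \<in> H0_dot m \<alpha> I" using f C0_infinity_subset_H0_dot by blast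
  ultimately show ?thesis
    using f C0_infinity_weak_deriv[OF f]
    unfolding weighted_ineq_C0_def weighted_ineq_H0_def by blast
qed

section \<open>Sign and continuity of the logarithmic weights\<close>

text \<open>Every term is built from squares, even powers and absolute values.\<close>

lemma W_weight_nonneg: "0 \<le> W_weight l \<alpha> N lam"
  unfolding W_weight_def B_const_def A_const_def
  by (intro add_nonneg_nonneg mult_nonneg_nonneg sum_nonneg prod_nonneg ballI) auto

text \<open>The indices that occur are 1 and those up to N; the shifted ones p + 1 stay within N
  because p \<le> N - 1.\<close>

lemma continuous_on_W_weight:
  assumes "1 \<le> N" "\<And>p. p \<le> N \<Longrightarrow> continuous_on I (lam p)"
  shows "continuous_on I (\<lambda>x. W_weight l \<alpha> N (\<lambda>p. lam p x))"
  unfolding W_weight_def using assms(1)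
  by (intro continuous_intros assms(2)) auto

lemma iter_ln_Suc: "iter_ln (Suc p) y = ln (iter_ln p y)"
  by (simp add: iter_ln_def)

lemma iter_exp_Suc: "iter_exp (Suc N) = exp (iter_exp N)"
  by (simp add: iter_exp_def)

lemma iter_exp_nonneg: "0 \<le> iter_exp N"
  by (cases N) (simp_all add: iter_exp_def)

text \<open>Each logarithm strips one exponential from the lower bound, which stays nonnegative for
  p \<le> N.\<close>

lemma iter_ln_gt:
  assumes "iter_exp N < y" "p \<le> N"
  shows "iter_exp (N - p) < iter_ln p y"
  using assms(2)
proof (induction p)
  case (Suc p)
  then have "exp (iter_exp (N - Suc p)) < iter_ln p y"
    by (simp add: Suc_diff_Suc flip: iter_exp_Suc)
  moreover from this have "0 < iter_ln p y"
    by (rule less_trans[OF exp_gt_zero])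
  ultimately show ?case
    using ln_less_cancel_iff[of "exp (iter_exp (N - Suc p))" "iter_ln p y"] by (simp add: iter_ln_Suc)
qed (use assms in \<open>simp add: iter_ln_def\<close>)

lemma iter_ln_pos:
  assumes "iter_exp N < y" "p \<le> N"
  shows "0 < iter_ln p y"
  using iter_ln_gt[OF assms] iter_exp_nonneg[of "N - p"] by linarith

lemma continuous_on_iter_ln: "p \<le> N \<Longrightarrow> continuous_on {iter_exp N<..} (iter_ln p)"
proof (induction p)
  case 0
  then show ?case by (simp add: iter_ln_def continuous_on_id)
next
  case (Suc p)
  have "iter_ln p y \<noteq> 0" if "y \<in> {iter_exp N<..}" for y
    using iter_ln_pos[of N y p] that Suc by auto
  then have "continuous_on {iter_exp N<..} (\<lambda>y. ln (iter_ln p y))"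
    using Suc by (intro continuous_intros) auto
  then show ?case by (simp add: iter_ln_Suc[abs_def])
qed

lemma norm_iter_ln_Suc: "norm_iter_ln (Suc p) s = inverse (1 - ln (norm_iter_ln p s))"
  by (simp add: norm_iter_ln_def)

text \<open>For s in (0, 1] the denominator 1 - ln s is at least 1, so one step maps (0, 1] into
  itself.\<close>

lemma norm_iter_ln_in: "s \<in> {0<..1} \<Longrightarrow> norm_iter_ln p s \<in> {0<..1}"
proof (induction p)
  case (Suc p)
  then have "1 \<le> 1 - ln (norm_iter_ln p s)" by simp
  then show ?case by (auto simp: norm_iter_ln_Suc inverse_le_1_iff)
qed (simp add: norm_iter_ln_def)

lemma continuous_on_norm_iter_ln: "continuous_on {0<..1} (norm_iter_ln p)"
proof (induction p)
  case 0
  then show ?case by (simp add: norm_iter_ln_def continuous_on_id)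
next
  case (Suc p)
  have "norm_iter_ln p s \<noteq> 0 \<and> 1 - ln (norm_iter_ln p s) \<noteq> 0" if "s \<in> {0<..1}" for s
  proof -
    have "0 < norm_iter_ln p s" "ln (norm_iter_ln p s) \<le> 0"
      using norm_iter_ln_in[OF that, of p] by auto
    then show ?thesis by linarith
  qed
  then have "continuous_on {0<..1} (\<lambda>s. inverse (1 - ln (norm_iter_ln p s)))"
    using Suc by (intro continuous_intros) auto
  then show ?case by (simp add: norm_iter_ln_Suc[abs_def])
qed

text \<open>In each of the four cases the inner quotient maps \<open>I\<close> into the set where
  the iterates are continuous: above \<open>iter_exp N\<close> for iterated logarithms, (0, 1] for
  normalized ones.\<close>

lemma continuous_on_log_weight:
  assumes "I = {\<rho><..} \<and>
             ((\<exists>\<gamma>>0. \<rho> \<ge> iter_exp N * \<gamma> \<and> lam = (\<lambda>p x. inverse (iter_ln p (x / \<gamma>))))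
              \<or> (\<exists>\<tau>>0. \<rho> \<ge> \<tau> \<and> lam = (\<lambda>p x. norm_iter_ln p (\<tau> / x))))
           \<or> I = {0<..<\<rho>} \<and>
             ((\<exists>\<gamma>. \<gamma> \<ge> iter_exp N * \<rho> \<and> lam = (\<lambda>p x. inverse (iter_ln p (\<gamma> / x))))
              \<or> (\<exists>\<tau>. \<rho> \<le> \<tau> \<and> lam = (\<lambda>p x. norm_iter_ln p (x / \<tau>))))"
    and "p \<le> N" "0 < \<rho>" "1 \<le> N"
  shows "continuous_on I (lam p)"
proof -
  have ln: "continuous_on I (\<lambda>x. inverse (iter_ln p (u x)))"
    if "continuous_on I u" "u ` I \<subseteq> {iter_exp N<..}" for u
  proof -
    have "iter_ln p (u x) \<noteq> 0" if "x \<in> I" for x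
      using iter_ln_pos[OF _ \<open>p \<le> N\<close>, of "u x"] that \<open>u ` I \<subseteq> _\<close> by fastforce
    then show ?thesis
      by (intro continuous_on_inverse continuous_on_compose2[OF continuous_on_iter_ln[OF \<open>p \<le> N\<close>] that])
         auto
  qed
  have norm: "continuous_on I (\<lambda>x. norm_iter_ln p (u x))"
    if "continuous_on I u" "u ` I \<subseteq> {0<..1}" for u
    by (rule continuous_on_compose2[OF continuous_on_norm_iter_ln that])
  \<comment> \<open>Since e_0 = 0, this rests on N \<ge> 1; on (0, \<rho>) it keeps the bound e_N x
    < e_N \<rho> strict.\<close>
  have pos: "0 < iter_exp N"
    using \<open>1 \<le> N\<close> by (cases N) (simp_all add: iter_exp_def)
  have out: "I = {\<rho><..} \<Longrightarrow> continuous_on I (\<lambda>x. c / x)" and inn: "I = {0<..<\<rho>} \<Longrightarrow> continuous_on I (\<lambda>x. c / x)" for c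
    using \<open>0 < \<rho>\<close> by (auto intro!: continuous_intros)
  from assms(1) show ?thesis
  proof (elim disjE conjE exE)
    fix \<gamma> assume I: "I = {\<rho><..}" and *: "0 < \<gamma>" "iter_exp N * \<gamma> \<le> \<rho>"
      and lam: "lam = (\<lambda>p x. inverse (iter_ln p (x / \<gamma>)))"
    show ?thesis
      unfolding lam using * by (intro ln continuous_intros) (auto simp: I field_simps)
  next
    fix \<tau> assume I: "I = {\<rho><..}" and *: "0 < \<tau>" "\<tau> \<le> \<rho>"
      and lam: "lam = (\<lambda>p x. norm_iter_ln p (\<tau> / x))"
    show ?thesis
      unfolding lam using * \<open>0 < \<rho>\<close> by (intro norm out I) (auto simp: I)
  next
    fix \<gamma> assume I: "I = {0<..<\<rho>}" and *: "iter_exp N * \<rho> \<le> \<gamma>"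
      and lam: "lam = (\<lambda>p x. inverse (iter_ln p (\<gamma> / x)))"
    have "iter_exp N < \<gamma> / x" if "x \<in> I" for x
    proof -
      have "iter_exp N * x < iter_exp N * \<rho>" using that I pos by auto
      then show ?thesis using * that I by (simp add: field_simps)
    qed
    then show ?thesis
      unfolding lam by (intro ln inn I) auto
  next
    fix \<tau> assume I: "I = {0<..<\<rho>}" and *: "\<rho> \<le> \<tau>"
      and lam: "lam = (\<lambda>p x. norm_iter_ln p (x / \<tau>))"
    show ?thesis
      unfolding lam using * \<open>0 < \<rho>\<close> by (intro norm continuous_intros) (auto simp: I)
  qed
qed

theorem theoremA1:
  fixes l m :: nat and \<alpha> \<rho> :: real and I :: "real set"
  assumes "1 \<le> l" and "l \<le> m"
    and "\<forall>j\<in>{1..l}. \<alpha> \<noteq> 2 * real j - 1"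
    and "0 < \<rho>"
    and "I = {0<..<\<rho>} \<or> I = {\<rho><..}"
  shows "C0_infinity I \<subseteq> H0_dot m \<alpha> I
    \<and> (\<forall>C > A_const l \<alpha>. \<exists>f\<in>C0_infinity I.
          (LINT x:I|lborel. x powr \<alpha> * (cmod (nth_vderiv m f x))\<^sup>2)
          < C * (LINT x:I|lborel. x powr (\<alpha> - 2 * real l) * (cmod (nth_vderiv (m - l) f x))\<^sup>2))
    \<and> (\<forall>C > A_const l \<alpha>. \<not> weighted_ineq_H0 I m l \<alpha> (\<lambda>_. C))
    \<and> (\<forall>N\<ge>1. \<forall>lam :: nat \<Rightarrow> real \<Rightarrow> real.
          (I = {\<rho><..} \<and>
             ((\<exists>\<gamma>>0. \<rho> \<ge> iter_exp N * \<gamma> \<and> lam = (\<lambda>p x. inverse (iter_ln p (x / \<gamma>))))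
              \<or> (\<exists>\<tau>>0. \<rho> \<ge> \<tau> \<and> lam = (\<lambda>p x. norm_iter_ln p (\<tau> / x))))
           \<or> I = {0<..<\<rho>} \<and>
             ((\<exists>\<gamma>. \<gamma> \<ge> iter_exp N * \<rho> \<and> lam = (\<lambda>p x. inverse (iter_ln p (\<gamma> / x))))
              \<or> (\<exists>\<tau>. \<rho> \<le> \<tau> \<and> lam = (\<lambda>p x. norm_iter_ln p (x / \<tau>)))))
          \<longrightarrow> (\<forall>C > A_const l \<alpha>.
                \<not> weighted_ineq_C0 I m l \<alpha> (\<lambda>x. C + W_weight l \<alpha> N (\<lambda>p. lam p x))
              \<and> \<not> weighted_ineq_H0 I m l \<alpha> (\<lambda>x. C + W_weight l \<alpha> N (\<lambda>p. lam p x))))"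
proof -
  have refuted: "\<not> weighted_ineq_C0 I m l \<alpha> (\<lambda>x. C + W x)" "\<not> weighted_ineq_H0 I m l \<alpha> (\<lambda>x. C + W x)"
    if "C > A_const l \<alpha>" "continuous_on I W" "\<And>x. 0 \<le> W x" for C W
    using not_weighted_ineq[OF assms(2,4,5) that] by auto
  show ?thesis
proof (intro conjI allI impI)
  show "C0_infinity I \<subseteq> H0_dot m \<alpha> I"
    by (rule C0_infinity_subset_H0_dot)
next
  fix C assume C: "C > A_const l \<alpha>"
  show "\<exists>f\<in>C0_infinity I.
      (LINT x:I|lborel. x powr \<alpha> * (cmod (nth_vderiv m f x))\<^sup>2)
      < C * (LINT x:I|lborel. x powr (\<alpha> - 2 * real l) * (cmod (nth_vderiv (m - l) f x))\<^sup>2)"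
    by (rule exists_near_extremal[OF assms(2,4,5) C])
  show "\<not> weighted_ineq_H0 I m l \<alpha> (\<lambda>_. C)"
    \<comment> \<open>The unrefined inequality is the case of zero extra weight.\<close>
    using refuted(2)[OF C, of "\<lambda>_. 0"] by simp
next
  fix N lam C
  assume "1 \<le> N" and C: "C > A_const l \<alpha>"
    and lam: "I = {\<rho><..} \<and>
             ((\<exists>\<gamma>>0. \<rho> \<ge> iter_exp N * \<gamma> \<and> lam = (\<lambda>p x. inverse (iter_ln p (x / \<gamma>))))
              \<or> (\<exists>\<tau>>0. \<rho> \<ge> \<tau> \<and> lam = (\<lambda>p x. norm_iter_ln p (\<tau> / x))))
           \<or> I = {0<..<\<rho>} \<and>
             ((\<exists>\<gamma>. \<gamma> \<ge> iter_exp N * \<rho> \<and> lam = (\<lambda>p x. inverse (iter_ln p (\<gamma> / x))))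
              \<or> (\<exists>\<tau>. \<rho> \<le> \<tau> \<and> lam = (\<lambda>p x. norm_iter_ln p (x / \<tau>))))"
  have "continuous_on I (lam p)" if "p \<le> N" for p
    by (rule continuous_on_log_weight[OF lam that assms(4) \<open>1 \<le> N\<close>])
  then have cont: "continuous_on I (\<lambda>x. W_weight l \<alpha> N (\<lambda>p. lam p x))"
    using \<open>1 \<le> N\<close> by (intro continuous_on_W_weight)
  show "\<not> weighted_ineq_C0 I m l \<alpha> (\<lambda>x. C + W_weight l \<alpha> N (\<lambda>p. lam p x))"
    "\<not> weighted_ineq_H0 I m l \<alpha> (\<lambda>x. C + W_weight l \<alpha> N (\<lambda>p. lam p x))"
    by (rule refuted[OF C cont W_weight_nonneg])+
qed
qed

end
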